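(* For every $n\in\mathbb{N}$, there exists a graph $G$ of order $n$ with $\delta(G)\geq\left\lfloor\frac56n\right\rfloor-2$ and a colouring of the edges of $G$ with three colours such that every monochromatic component has order strictly less than $\frac n2$.
   Context: $\delta(G)$ denotes the minimum degree of $G$. For an edge-colouring of $G$, a monochromatic component of a given colour is a connected component of the graph formed by the edges of that colour (on the vertices incident with such edges); its order is its number of vertices.
   Formalization: The order n = 4 is excluded, because there the claim is false: minimum degree at least 1 forces an edge, and its monochromatic component has order at least 2 = n/2. *)

theory Defs
  imports Complex_Main
begin

text \<open>Finite simple graphs are pairs of a vertex set and a set of two-element edges.\<close>

definition simple_graph :: "'a set \<Rightarrow> 'a set set \<Rightarrow> bool" where
  "simple_graph V E \<longleftrightarrow> finite V \<and> (\<forall>e\<in>E. e \<subseteq> V \<and> card e = 2)"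

definition degree :: "'a set set \<Rightarrow> 'a \<Rightarrow> nat" where
  "degree E v = card {e \<in> E. v \<in> e}"

text \<open>Using \<open>Inf\<close> on \<open>nat\<close> fixes the minimum degree of the null graph to be \<open>0\<close>.\<close>

definition min_degree :: "'a set \<Rightarrow> 'a set set \<Rightarrow> nat" where
  "min_degree V E = (INF v\<in>V. degree E v)"

text \<open>Components are represented by their vertex sets.\<close>

definition connected_components :: "'a set \<Rightarrow> 'a set set \<Rightarrow> 'a set set" where
  "connected_components V E =
     V // {(u, v). u \<in> V \<and> v \<in> V \<and> (u, v) \<in> {(x, y). {x, y} \<in> E}\<^sup>*}"

definition colour_class :: "'a set set \<Rightarrow> ('a set \<Rightarrow> 'c) \<Rightarrow> 'c \<Rightarrow> 'a set set" where
  "colour_class E c i = {e \<in> E. c e = i}"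

text \<open>The vertices of the colour graph are only those incident with an edge of that colour.\<close>

definition mono_components :: "'a set set \<Rightarrow> ('a set \<Rightarrow> 'c) \<Rightarrow> 'c \<Rightarrow> 'a set set" where
  "mono_components E c i =
     connected_components (\<Union>(colour_class E c i)) (colour_class E c i)"

definition small_mono_colouring :: "nat \<Rightarrow> 'a set \<Rightarrow> 'a set set \<Rightarrow> ('a set \<Rightarrow> nat) \<Rightarrow> bool" where
  "small_mono_colouring n V E c \<longleftrightarrow>
     c ` E \<subseteq> {1, 2, 3} \<and>
     (\<forall>i\<in>{1, 2, 3}. \<forall>K\<in>mono_components E c i. real (card K) < real n / 2)"

text \<open>
  For \<open>n = 4\<close> the degree bound \<open>\<lfloor>5 n / 6\<rfloor> - 2 = 1\<close> forces an edge, whose monochromatic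
  component has at least \<open>2 = n / 2\<close> vertices.  Hence no graph of order \<open>4\<close> has the property
  and this single order has to be excluded.
\<close>

lemma no_small_mono_colouring_order_4:
  fixes V :: "'a set"
  assumes "simple_graph V E" "card V = 4"
    and "int (min_degree V E) \<ge> \<lfloor>5 / 6 * real 4\<rfloor> - 2"
  shows "\<not> small_mono_colouring 4 V E c"
proof
  assume small: "small_mono_colouring 4 V E c"
  have "\<lfloor>5 / 6 * real 4\<rfloor> = 3" by (simp add: floor_eq_iff)
  hence md: "min_degree V E \<ge> 1" using assms(3) by simp
  obtain v where v: "v \<in> V" using assms(2) by (metis card.empty ex_in_conv zero_neq_numeral)
  have "min_degree V E \<le> degree E v"
    unfolding min_degree_def using v by (intro cINF_lower) auto
  hence "{e \<in> E. v \<in> e} \<noteq> {}" using md unfolding degree_def by (metis card.empty not_one_le_zero le_trans)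
  then obtain e where e: "e \<in> E" "v \<in> e" by blast
  define F where "F = colour_class E c (c e)"
  define R where "R = {(u, v). u \<in> \<Union>F \<and> v \<in> \<Union>F \<and> (u, v) \<in> {(x, y). {x, y} \<in> F}\<^sup>*}"
  have eF: "e \<in> F" using e by (simp add: F_def colour_class_def)
  have "R `` {v} \<in> mono_components E c (c e)"
    unfolding mono_components_def connected_components_def F_def[symmetric] R_def[symmetric]
    using eF e by (intro quotientI) blast
  moreover have "c e \<in> {1, 2, 3}" using small e unfolding small_mono_colouring_def by blast
  ultimately have lt: "real (card (R `` {v})) < 2"
    using small unfolding small_mono_colouring_def by fastforce
  have sub: "e \<subseteq> R `` {v}"
  proof
    fix w assume w: "w \<in> e"
    have c2: "card e = 2" using assms(1) e unfolding simple_graph_def by blast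
    have "(v, w) \<in> {(x, y). {x, y} \<in> F}\<^sup>*"
    proof (cases "w = v")
      case False
      have "finite e" using c2 by (simp add: card_ge_0_finite)
      hence "{v, w} = e" using False c2 w e by (intro card_subset_eq) auto
      thus ?thesis using eF by auto
    qed simp
    thus "w \<in> R `` {v}" unfolding R_def using eF e w by auto
  qed
  have "R `` {v} \<subseteq> V"
    using assms(1) unfolding R_def F_def colour_class_def simple_graph_def by auto
  hence "finite (R `` {v})" using assms(1) unfolding simple_graph_def by (metis finite_subset)
  hence "card e \<le> card (R `` {v})" using sub by (rule card_mono)
  moreover have "card e = 2" using assms(1) e unfolding simple_graph_def by blast
  ultimately show False using lt by simp
qed

end

theory Submission
  imports Defs
begin

text \<open>
  Label every vertex with a triple, join two vertices when their labels agree in some coordinate,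
  and colour the edge by such a coordinate.  A monochromatic component then lies in a fibre of
  one coordinate, so it suffices that every such fibre has fewer than \<open>n / 2\<close> elements and that
  every label clashes (differs in all coordinates) with at most \<open>\<lceil>n / 6\<rceil> + 1\<close> others.
  Adding one vertex with each of the six non-constant labels in \<open>{0, 1}\<^sup>3\<close> raises \<open>n\<close> by \<open>6\<close>, every
  fibre by at most \<open>3\<close>, and every number of clashes by at most \<open>1\<close>, provided that no label in
  use clashes with more than one of the six.  This reduces the problem to orders \<open>5, \<dots>, 10\<close>;
  for \<open>n \<le> 3\<close> the edgeless graph will do.
\<close>

definition label_graph :: "'a set \<Rightarrow> 'i set \<Rightarrow> ('i \<Rightarrow> 'a \<Rightarrow> 'b) \<Rightarrow> 'a set set" where
  "label_graph V I f = {{u, v} | u v. u \<in> V \<and> v \<in> V \<and> u \<noteq> v \<and> (\<exists>i\<in>I. f i u = f i v)}"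

text \<open>Labels may agree in several coordinates. Any choice among these serves, since only
  agreement along an edge in the coordinate of its own colour matters.\<close>

definition label_colour :: "'i set \<Rightarrow> ('i \<Rightarrow> 'a \<Rightarrow> 'b) \<Rightarrow> 'a set \<Rightarrow> 'i" where
  "label_colour I f e = (SOME i. i \<in> I \<and> (\<forall>u\<in>e. \<forall>v\<in>e. f i u = f i v))"

lemma simple_graph_label_graph: "finite V \<Longrightarrow> simple_graph V (label_graph V I f)"
  by (auto simp: simple_graph_def label_graph_def)

lemma label_colour:
  assumes "e \<in> label_graph V I f"
  shows "label_colour I f e \<in> I"
    and "u \<in> e \<Longrightarrow> v \<in> e \<Longrightarrow> f (label_colour I f e) u = f (label_colour I f e) v"
proof -
  have "\<exists>i. i \<in> I \<and> (\<forall>u\<in>e. \<forall>v\<in>e. f i u = f i v)"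
    using assms by (auto simp: label_graph_def)
  then have *: "label_colour I f e \<in> I \<and>
      (\<forall>u\<in>e. \<forall>v\<in>e. f (label_colour I f e) u = f (label_colour I f e) v)"
    unfolding label_colour_def by (rule someI_ex)
  then show "label_colour I f e \<in> I"
    and "u \<in> e \<Longrightarrow> v \<in> e \<Longrightarrow> f (label_colour I f e) u = f (label_colour I f e) v"
    by blast+
qed

lemma degree_label_graph:
  assumes "v \<in> V"
  shows "degree (label_graph V I f) v = card {u \<in> V. u \<noteq> v \<and> (\<exists>i\<in>I. f i u = f i v)}"
proof -
  have "{e \<in> label_graph V I f. v \<in> e}
      = (\<lambda>u. {u, v}) ` {u \<in> V. u \<noteq> v \<and> (\<exists>i\<in>I. f i u = f i v)}" (is "?L = ?g ` ?R")
    using assms by (force simp: label_graph_def image_iff insert_commute)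
  moreover have "inj_on ?g ?R"
    by (auto simp: inj_on_def doubleton_eq_iff)
  ultimately show ?thesis
    by (simp add: degree_def card_image)
qed

text \<open>Each edge of colour \<open>i\<close> joins vertices with equal \<open>f i\<close>, so
  \<open>f i\<close> is constant along paths in that colour.\<close>

lemma mono_components_label_graph:
  assumes "K \<in> mono_components (label_graph V I f) (label_colour I f) i"
  obtains v where "v \<in> V" and "K \<subseteq> {u \<in> V. f i u = f i v}"
proof -
  define F where "F = colour_class (label_graph V I f) (label_colour I f) i"
  have F: "x \<in> V" "f i x = f i y" if "{x, y} \<in> F" for x y
    using that label_colour(2)[of "{x, y}" V I f x y]
    by (auto simp: F_def colour_class_def label_graph_def doubleton_eq_iff)
  have FV: "\<Union>F \<subseteq> V"
    by (auto simp: F_def colour_class_def label_graph_def)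
  have path: "f i y = f i x" if "(x, y) \<in> {(x, y). {x, y} \<in> F}\<^sup>*" for x y
    using that by induction (simp, metis F(2) mem_Collect_eq case_prodD)
  obtain v where "v \<in> \<Union>F" and
    K: "K = {(u, v). u \<in> \<Union>F \<and> v \<in> \<Union>F \<and> (u, v) \<in> {(x, y). {x, y} \<in> F}\<^sup>*} `` {v}"
    using assms unfolding mono_components_def connected_components_def F_def[symmetric]
    by (rule quotientE)
  then have "K \<subseteq> {u \<in> V. f i u = f i v}"
    using FV by (auto intro: path)
  with \<open>v \<in> \<Union>F\<close> FV show thesis
    by (intro that) auto
qed

text \<open>The indices are the colours 1, 2, 3 themselves; any other index falls through to the
  third coordinate.\<close>

fun coord :: "nat \<Rightarrow> nat \<times> nat \<times> nat \<Rightarrow> nat" where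
  "coord i (a, b, c) = (if i = 1 then a else if i = 2 then b else c)"

definition clash :: "nat \<times> nat \<times> nat \<Rightarrow> nat \<times> nat \<times> nat \<Rightarrow> bool" where
  "clash s t \<longleftrightarrow> (\<forall>i\<in>{1, 2, 3}. coord i s \<noteq> coord i t)"

text \<open>Binary triples clash exactly when they are complementary, so these six form three
  clashing pairs. A label with a single coordinate outside 0 and 1 clashes with just one of them if
  its other two coordinates are equal.\<close>

definition cube_labels :: "(nat \<times> nat \<times> nat) list" where
  "cube_labels = [(0,0,1), (0,1,0), (1,0,0), (1,1,0), (1,0,1), (0,1,1)]"

text \<open>\<open>t\<close> also runs over \<open>cube_labels\<close>, so that the property
  survives appending them. The clash bound is additive to avoid truncated subtraction.\<close>

definition good_labels :: "(nat \<times> nat \<times> nat) list \<Rightarrow> bool" where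
  "good_labels xs \<longleftrightarrow> (\<forall>t\<in>set (xs @ cube_labels).
     length (filter (clash t) xs) + 5 * length xs div 6 \<le> length xs + 1 \<and>
     length (filter (clash t) cube_labels) \<le> 1 \<and>
     (\<forall>i\<in>{1, 2, 3}. 2 * length (filter (\<lambda>s. coord i s = coord i t) xs) < length xs \<and>
        length (filter (\<lambda>s. coord i s = coord i t) cube_labels) \<le> 3))"

text \<open>The term \<open>5 * length xs div 6\<close> grows by exactly 5 and a clash count by at
  most 1, which the 6 new entries balance. Twice a fibre grows by at most 6.\<close>

lemma good_labels_append_cube:
  assumes "good_labels xs"
  shows "good_labels (xs @ cube_labels)"
proof -
  have [simp]: "length cube_labels = 6"
    by (simp add: cube_labels_def)
  show ?thesis
    unfolding good_labels_def
  proof (intro ballI conjI)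
    fix t assume "t \<in> set ((xs @ cube_labels) @ cube_labels)"
    then have t: "t \<in> set (xs @ cube_labels)"
      by auto
    show cube: "length (filter (clash t) cube_labels) \<le> 1"
      using assms t unfolding good_labels_def by blast
    have "length (filter (clash t) xs) + 5 * length xs div 6 \<le> length xs + 1"
      using assms t unfolding good_labels_def by blast
    then show "length (filter (clash t) (xs @ cube_labels)) + 5 * length (xs @ cube_labels) div 6
        \<le> length (xs @ cube_labels) + 1"
      using cube by simp
    fix i :: nat assume i: "i \<in> {1, 2, 3}"
    show fibre: "length (filter (\<lambda>s. coord i s = coord i t) cube_labels) \<le> 3"
      using assms t i unfolding good_labels_def by blast
    have "2 * length (filter (\<lambda>s. coord i s = coord i t) xs) < length xs"
      using assms t i unfolding good_labels_def by blast
    then show "2 * length (filter (\<lambda>s. coord i s = coord i t) (xs @ cube_labels))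
        < length (xs @ cube_labels)"
      using fibre by simp
  qed
qed

text \<open>
  The base lists were found by a computer search.  A coordinate value \<open>2\<close> or \<open>3\<close> takes a
  vertex out of the two large fibres.
\<close>

lemma good_labels_base:
  "good_labels [(0,1,1), (0,2,0), (1,0,1), (1,1,3), (2,0,0)]"
  "good_labels [(0,0,3), (0,2,0), (1,1,3), (1,2,1), (3,0,0), (3,1,1)]"
  "good_labels [(0,0,2), (0,1,0), (0,3,0), (1,0,1), (1,1,2), (1,3,1), (3,1,1)]"
  "good_labels [(0,0,2), (0,1,1), (0,3,0), (1,0,0), (1,1,3), (1,2,1), (3,0,0), (3,1,1)]"
  "good_labels [(0,0,0), (0,0,2), (0,1,1), (1,0,0), (1,1,0), (1,1,2), (1,3,1), (3,0,0), (3,1,1)]"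
  "good_labels [(0,0,1), (0,0,3), (0,1,0), (0,2,0), (1,0,0), (1,1,3), (1,2,1), (3,0,0), (3,1,1),
     (3,1,1)]"
  by code_simp+

lemma good_labels_exist:
  assumes "n \<ge> 5"
  shows "\<exists>xs. length xs = n \<and> good_labels xs"
  using assms
proof (induction n rule: less_induct)
  case (less n)
  show ?case
  proof (cases "n \<le> 10")
    case True
    with less.prems have "n \<in> {5, 6, 7, 8, 9, 10}"
      by auto
    moreover have "good_labels xs \<Longrightarrow> length xs = n \<Longrightarrow> ?thesis" for xs
      by blast
    ultimately show ?thesis
      using good_labels_base by (elim insertE emptyE) simp_all
  next
    case False
    then have "n - 6 < n" "5 \<le> n - 6"
      by linarith+
    then obtain xs where "length xs = n - 6" "good_labels xs"
      using less.IH by blast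
    with False have "length (xs @ cube_labels) = n"
      by (simp add: cube_labels_def)
    with good_labels_append_cube[OF \<open>good_labels xs\<close>] show ?thesis
      by blast
  qed
qed

lemma floor_five_sixths: "\<lfloor>5 / 6 * real n\<rfloor> = int (5 * n div 6)"
proof -
  have "5 / 6 * real n = real_of_int (int (5 * n)) / real_of_int 6"
    by simp
  then show ?thesis
    by (metis floor_divide_of_int_eq of_nat_numeral zdiv_int)
qed

theorem theorem1p6:
  fixes n :: nat
  assumes "n \<noteq> 4"
  shows "\<exists>(V :: nat set) E c.
           simple_graph V E \<and> card V = n \<and>
           int (min_degree V E) \<ge> \<lfloor>5 / 6 * real n\<rfloor> - 2 \<and>
           small_mono_colouring n V E c"
proof (cases "n \<ge> 5")
  case False
  \<comment> \<open>Now \<open>n \<le> 3\<close>, so the required degree is at most 0; order 4 would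
    give 3 here. Without edges there are no monochromatic components.\<close>
  with assms have "5 * n div 6 \<le> 2"
    by auto
  then show ?thesis
    unfolding floor_five_sixths
    by (intro exI[of _ "{..<n}"] exI[of _ "{}"])
      (auto simp: simple_graph_def small_mono_colouring_def mono_components_def
        connected_components_def colour_class_def)
next
  case True
  then obtain xs where len: "length xs = n" and good: "good_labels xs"
    using good_labels_exist by blast
  define I :: "nat set" where "I = {1, 2, 3}"
  \<comment> \<open>Vertices are list positions rather than labels, because labels may
    repeat.\<close>
  define f where "f i u = coord i (xs ! u)" for i u
  define E where "E = label_graph {..<n} I f"
  have deg: "degree E v \<ge> 5 * n div 6 - 2" if v: "v \<in> {..<n}" for v
  proof -
    define A where "A = {u \<in> {..<n}. u \<noteq> v \<and> (\<exists>i\<in>I. f i u = f i v)}"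
    define B where "B = {u. u < length xs \<and> clash (xs ! v) (xs ! u)}"
    \<comment> \<open>A vertex other than \<open>v\<close> is a neighbour or clashes with
      \<open>v\<close>. The 2 in the degree bound is 1 for \<open>v\<close> itself plus the spare 1
      in the bound on \<open>card B\<close>.\<close>
    have "{..<n} = insert v (A \<union> B)"
      using v len by (auto simp: A_def B_def clash_def f_def I_def)
    then have "card {..<n} \<le> Suc (card (A \<union> B))"
      by (simp only: card_insert_le_m1 diff_Suc_1 zero_less_Suc)
    then have "n \<le> Suc (card (A \<union> B))"
      by simp
    moreover have "card (A \<union> B) \<le> card A + card B"
      by (rule card_Un_le)
    moreover have "card B + 5 * n div 6 \<le> n + 1"
      using good len v by (simp add: good_labels_def B_def length_filter_conv_card)
    moreover have "degree E v = card A"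
      unfolding E_def A_def using v by (rule degree_label_graph)
    ultimately show ?thesis
      by linarith
  qed
  have "{..<n} \<noteq> {}"
    using True by (auto simp: lessThan_empty_iff)
  then have "min_degree {..<n} E \<ge> 5 * n div 6 - 2"
    unfolding min_degree_def using deg by (rule cINF_greatest)
  moreover have "simple_graph {..<n} E"
    by (simp add: E_def simple_graph_label_graph)
  moreover have "small_mono_colouring n {..<n} E (label_colour I f)"
    unfolding small_mono_colouring_def
  proof (intro conjI ballI)
    show "label_colour I f ` E \<subseteq> {1, 2, 3}"
      using label_colour(1)[of _ "{..<n}" I f] by (auto simp: E_def I_def)
    fix i K assume i: "i \<in> {1, 2, 3}" and "K \<in> mono_components E (label_colour I f) i"
    then obtain v where v: "v \<in> {..<n}" and K: "K \<subseteq> {u \<in> {..<n}. f i u = f i v}"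
      unfolding E_def by (elim mono_components_label_graph)
    have "card K \<le> card {u \<in> {..<n}. f i u = f i v}"
      using K by (intro card_mono) auto
    also have "\<dots> = length (filter (\<lambda>s. coord i s = coord i (xs ! v)) xs)"
      using len by (simp add: length_filter_conv_card f_def)
    finally have "2 * card K \<le> 2 * length (filter (\<lambda>s. coord i s = coord i (xs ! v)) xs)"
      by simp
    also have "\<dots> < n"
      using good i v len unfolding good_labels_def by auto
    finally show "real (card K) < real n / 2"
      by linarith
  qed
  ultimately show ?thesis
    unfolding floor_five_sixths
    by (intro exI[of _ "{..<n}"] exI[of _ E] exI[of _ "label_colour I f"]) auto
qed

end
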